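(* Let $\{\mathbf{u}^n\}_{n=0}^\infty\subset U$ be a sequence such that the linearized constraint $B(\dot{\mathbf{u}}^n,\hat{\mathbf{u}}^n)=0$ holds for every $n\ge k$, where $\dot{\mathbf{u}}^n$ and $\hat{\mathbf{u}}^n$ are the BDF-$k$ approximation of the time derivative and the BDF-$k$ extrapolation, respectively. Put $b_n:=B(\mathbf{u}^n,\mathbf{u}^n)-\mathbf{u}_c$. Then for every fixed $2\le k\le 6$ and every $N\ge k$, $$b_N=\sum_{m=1}^{k-1}\Big(\tilde\delta_{k-1-m}\sum_{n=k}^N\eta_{N-n}-\sum_{\ell=k-m}^{k-1}\tilde\delta_{\ell}\,\eta_{N-\ell-m}\Big)b_m+\sum_{n=k}^N\eta_{N-n}\sum_{m=k}^n\phi_m .$$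
   Context: $U$ is a real Hilbert space, $Z$ is a (normed) function space, $B:U\times U\to Z$ is a symmetric bilinear operator, $\mathbf{u}_c\in Z$ is given, and $s>0$ is a step size. BDF coefficients: for $k\ge1$, $\delta_0=\sum_{r=1}^k\frac1r$, $\delta_i=\frac{(-1)^i}{i}\binom{k}{i}$ for $1\le i\le k$, $\gamma_j=(-1)^j\binom{k}{j+1}$ for $0\le j\le k-1$, and $\tilde\delta_j=\sum_{\ell=0}^j\delta_\ell$ for $0\le j\le k-1$. The BDF-$k$ quantities are $$\dot{\mathbf{u}}^n=\frac1s\sum_{j=0}^k\delta_j\mathbf{u}^{n-j},\qquad \hat{\mathbf{u}}^n=\sum_{j=0}^{k-1}\gamma_j\mathbf{u}^{n-j-1}.$$ The numbers $\eta_j$ are the Taylor coefficients at $0$ of $1/\tilde\delta(z)$ with $\tilde\delta(z)=\sum_{j=0}^{k-1}\tilde\delta_jz^j$; equivalently $\eta_0=\tilde\delta_0^{-1}$, $\sum_{j=0}^{k-1}\tilde\delta_j\eta_{n-j}=0$ for $n\ge1$, with $\eta_j=0$ for $j<0$. Backward differences: $d_t\mathbf{u}^n=(\mathbf{u}^n-\mathbf{u}^{n-1})/s$ and $d_t^j\mathbf{u}^n=(d_t^{j-1}\mathbf{u}^n-d_t^{j-1}\mathbf{u}^{n-1})/s$ for $j\ge 2$. For $n\ge k$, $$\phi_n:=\sum_{j=1}^k\sum_{\ell=0}^{k-j}\beta_{j\ell}\,s^{2j}B(d_t^j\mathbf{u}^{n-\ell},d_t^j\mathbf{u}^{n-\ell}),$$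 where $\beta_{j\ell}$ ($1\le j\le k$, $0\le\ell\le k-j$) are the unique real numbers, depending only on $k$, such that for every real-valued sequence $(a_n)$ and every $n\ge k$, $$\sum_{j=0}^k\delta_ja_{n-j}^2-2\Big(\sum_{j=0}^k\delta_ja_{n-j}\Big)\Big(\sum_{j=0}^{k-1}\gamma_ja_{n-j-1}\Big)=\sum_{j=1}^k\sum_{\ell=0}^{k-j}\beta_{j\ell}s^{2j}(d_t^ja_{n-\ell})^2 .$$
   Formalization: The formal theorem adds the hypothesis B(u^0,u^0)=u_c (i.e. b_0=0), without which the formula is false (for example u^n=0 for all n, u_c≠0, k=N=2). *)

theory Defs
  imports "HOL-Analysis.Analysis"
begin

definition bdf_delta :: "nat \<Rightarrow> nat \<Rightarrow> real" where
  "bdf_delta k i = (if i = 0 then (\<Sum>r=1..k. 1 / real r)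
                    else (-1) ^ i / real i * real (k choose i))"

definition bdf_gamma :: "nat \<Rightarrow> nat \<Rightarrow> real" where
  "bdf_gamma k j = (-1) ^ j * real (k choose (j + 1))"

definition bdf_delta_tilde :: "nat \<Rightarrow> nat \<Rightarrow> real" where
  "bdf_delta_tilde k j = (\<Sum>l=0..j. bdf_delta k l)"

definition bdf_delta_tilde_fun :: "nat \<Rightarrow> real \<Rightarrow> real" where
  "bdf_delta_tilde_fun k z = (\<Sum>j=0..k-1. bdf_delta_tilde k j * z ^ j)"

text \<open>The index of \<open>\<eta>\<close> is an integer, since negative indices (with value 0) occur.\<close>

definition bdf_eta :: "nat \<Rightarrow> int \<Rightarrow> real" where
  "bdf_eta k j = (if j < 0 then 0
     else (deriv ^^ nat j) (\<lambda>z. 1 / bdf_delta_tilde_fun k z) 0 / fact (nat j))"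

text \<open>\<open>bdf_dot\<close> and \<open>bdf_hat\<close> are used only for \<open>n \<ge> k \<ge> 1\<close>, where the subtractions on indices are exact.\<close>

definition bdf_dot :: "nat \<Rightarrow> real \<Rightarrow> (nat \<Rightarrow> 'a::real_vector) \<Rightarrow> nat \<Rightarrow> 'a" where
  "bdf_dot k s u n = (1 / s) *\<^sub>R (\<Sum>j=0..k. bdf_delta k j *\<^sub>R u (n - j))"

definition bdf_hat :: "nat \<Rightarrow> (nat \<Rightarrow> 'a::real_vector) \<Rightarrow> nat \<Rightarrow> 'a" where
  "bdf_hat k u n = (\<Sum>j=0..k-1. bdf_gamma k j *\<^sub>R u (n - j - 1))"

text \<open>\<open>back_diff s j u n\<close> is \<open>d\<^sub>t\<^sup>j u\<^sup>n\<close>; it is used only for \<open>j \<le> n\<close>, where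
  no index below 0 is reached.\<close>

primrec back_diff :: "real \<Rightarrow> nat \<Rightarrow> (nat \<Rightarrow> 'a::real_vector) \<Rightarrow> nat \<Rightarrow> 'a" where
  "back_diff s 0 u n = u n"
| "back_diff s (Suc j) u n = (1 / s) *\<^sub>R (back_diff s j u n - back_diff s j u (n - 1))"

definition is_bdf_beta :: "nat \<Rightarrow> (nat \<Rightarrow> nat \<Rightarrow> real) \<Rightarrow> bool" where
  "is_bdf_beta k \<beta> \<longleftrightarrow>
     (\<forall>s>0. \<forall>a :: nat \<Rightarrow> real. \<forall>n\<ge>k.
        (\<Sum>j=0..k. bdf_delta k j * (a (n - j))\<^sup>2)
          - 2 * (\<Sum>j=0..k. bdf_delta k j * a (n - j))
              * (\<Sum>j=0..k-1. bdf_gamma k j * a (n - j - 1))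
        = (\<Sum>j=1..k. \<Sum>l=0..k-j. \<beta> j l * s ^ (2 * j) * (back_diff s j a (n - l))\<^sup>2))"

text \<open>The coefficients are unique on the index range \<open>1 \<le> j \<le> k\<close>, \<open>l \<le> k - j\<close> only; the
  value 0 outside this range makes the function itself unique.\<close>

definition bdf_beta :: "nat \<Rightarrow> nat \<Rightarrow> nat \<Rightarrow> real" where
  "bdf_beta k = (THE \<beta>. is_bdf_beta k \<beta> \<and>
     (\<forall>j l. \<not> (1 \<le> j \<and> j \<le> k \<and> l \<le> k - j) \<longrightarrow> \<beta> j l = 0))"

definition bdf_phi ::
  "nat \<Rightarrow> real \<Rightarrow> ('u::real_vector \<Rightarrow> 'u \<Rightarrow> 'z::real_vector) \<Rightarrow> (nat \<Rightarrow> 'u) \<Rightarrow> nat \<Rightarrow> 'z" where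
  "bdf_phi k s B u n =
     (\<Sum>j=1..k. \<Sum>l=0..k-j. (bdf_beta k j l * s ^ (2 * j)) *\<^sub>R
        B (back_diff s j u (n - l)) (back_diff s j u (n - l)))"

definition constraint_defect ::
  "('u \<Rightarrow> 'u \<Rightarrow> 'z::ab_group_add) \<Rightarrow> 'z \<Rightarrow> (nat \<Rightarrow> 'u) \<Rightarrow> nat \<Rightarrow> 'z" where
  "constraint_defect B u_c u n = B (u n) (u n) - u_c"

end

theory Submission
  imports Defs
begin

text \<open>The identity defining the \<open>\<beta>\<close> is an equality of symmetric matrices on \<open>{0..k}\<close>, so it persists
  when products of scalars are replaced by a symmetric bilinear \<open>B\<close>; such \<open>\<beta>\<close> exist because
  \<open>\<Sum>\<delta>\<^sub>j = 0\<close> and \<open>\<Sum>\<gamma>\<^sub>j = 1\<close> make the rows of the matrix sum to 0, and the squares of backward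
  differences form a basis of such matrices. With the linearized constraint this gives
  \<open>\<Sum>\<delta>\<^sub>j b\<^bsub>n-j\<^esub> = \<phi>\<^sub>n\<close>, i.e. \<open>S\<^sub>n - S\<^bsub>n-1\<^esub> = \<phi>\<^sub>n\<close> for \<open>S\<^sub>n = \<Sum>\<delta>~\<^sub>j b\<^bsub>n-j\<^esub>\<close>. Summing, and
  convolving with the coefficients \<open>\<eta>\<close> of the inverse power series of \<open>\<delta>~\<close>, recovers \<open>b\<^sub>N\<close>.\<close>

subsection \<open>Squares of backward differences as quadratic forms\<close>

text \<open>Up to the factor \<open>s ^ j\<close>, the coefficient of \<open>u (n - p)\<close> in
  the \<open>j\<close>-th backward difference at \<open>n - l\<close>. It is supported on
  \<open>{l..l + j}\<close>: the guard cuts off below (truncated subtraction would not), the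
  binomial above.\<close>

definition diff_coeff :: "nat \<Rightarrow> nat \<Rightarrow> nat \<Rightarrow> real" where
  "diff_coeff j l p = (if l \<le> p then (-1) ^ (p - l) * real (j choose (p - l)) else 0)"

text \<open>Pascal's rule. Since \<open>n - 1 - i = n - Suc i\<close> also for truncated
  subtraction, the formula holds at every \<open>n\<close>.\<close>

lemma back_diff_eq_sum:
  "back_diff s j u n = (1 / s) ^ j *\<^sub>R (\<Sum>i\<le>j. ((-1) ^ i * real (j choose i)) *\<^sub>R u (n - i))"
proof (induction j arbitrary: n)
  case 0
  show ?case by simp
next
  case (Suc j)
  let ?c = "\<lambda>i. (-1) ^ i * real (j choose i)"
  have "(\<Sum>i\<le>Suc j. ((-1) ^ i * real (Suc j choose i)) *\<^sub>R u (n - i))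
      = u n + (\<Sum>i\<le>j. (- ?c i + ?c (Suc i)) *\<^sub>R u (n - Suc i))"
    by (subst sum.atMost_Suc_shift) (simp add: algebra_simps)
  also have "\<dots> = (u n + (\<Sum>i\<le>j. ?c (Suc i) *\<^sub>R u (n - Suc i))) - (\<Sum>i\<le>j. ?c i *\<^sub>R u (n - Suc i))"
    by (simp add: scaleR_left_distrib scaleR_left_diff_distrib sum.distrib sum_negf sum_subtractf)
  also have "u n + (\<Sum>i\<le>j. ?c (Suc i) *\<^sub>R u (n - Suc i)) = (\<Sum>i\<le>Suc j. ?c i *\<^sub>R u (n - i))"
    by (subst sum.atMost_Suc_shift) simp
  also have "\<dots> = (\<Sum>i\<le>j. ?c i *\<^sub>R u (n - i))"
    by simp
  finally show ?case
    by (simp add: Suc.IH scaleR_diff_right)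
qed

lemma back_diff_eq_sum_diff_coeff:
  assumes "l + j \<le> k"
  shows "back_diff s j u (n - l) = (1 / s) ^ j *\<^sub>R (\<Sum>p\<le>k. diff_coeff j l p *\<^sub>R u (n - p))"
proof -
  have "(\<Sum>p\<le>k. diff_coeff j l p *\<^sub>R u (n - p)) = (\<Sum>p\<in>(+) l ` {..j}. diff_coeff j l p *\<^sub>R u (n - p))"
  proof (rule sum.mono_neutral_right)
    show "\<forall>p\<in>{..k} - (+) l ` {..j}. diff_coeff j l p *\<^sub>R u (n - p) = 0"
    proof
      fix p assume "p \<in> {..k} - (+) l ` {..j}"
      then have "p < l \<or> l + j < p"
        by (metis DiffD2 atMost_iff image_eqI le_add_diff_inverse less_diff_conv2 linorder_not_le
            add.commute le_diff_conv)
      then show "diff_coeff j l p *\<^sub>R u (n - p) = 0"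
        by (auto simp: diff_coeff_def)
    qed
  qed (use assms in auto)
  also have "\<dots> = (\<Sum>i\<le>j. ((-1) ^ i * real (j choose i)) *\<^sub>R u (n - l - i))"
    by (subst sum.reindex) (auto simp: diff_coeff_def)
  finally show ?thesis
    by (simp add: back_diff_eq_sum)
qed

lemma back_diff_const: "1 \<le> j \<Longrightarrow> back_diff s j (\<lambda>_. c) n = 0"
proof (induction j arbitrary: n)
  case (Suc j)
  then show ?case by (cases "j = 0") auto
qed simp

text \<open>Differences of order at least 1 kill the constant sequence 1.\<close>

lemma sum_diff_coeff_eq_0:
  assumes "1 \<le> j" "l + j \<le> k"
  shows "(\<Sum>p\<le>k. diff_coeff j l p) = 0"
  using back_diff_eq_sum_diff_coeff[OF assms(2), of 1 "\<lambda>_. 1::real" 0]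
    back_diff_const[OF assms(1), of 1 "1::real" 0]
  by simp

text \<open>For \<open>w = k\<close> this is the matrix of the right-hand side of the identity
  defining \<beta>; the cutoff \<open>w\<close> on the order is the induction parameter.\<close>

definition diff_quad :: "nat \<Rightarrow> (nat \<Rightarrow> nat \<Rightarrow> real) \<Rightarrow> nat \<Rightarrow> nat \<Rightarrow> nat \<Rightarrow> real" where
  "diff_quad k \<beta> w p q = (\<Sum>j=1..w. \<Sum>l=0..k-j. \<beta> j l * (diff_coeff j l p * diff_coeff j l q))"

lemma diff_quad_Suc:
  "diff_quad k \<beta> (Suc w) p q = diff_quad k \<beta> w p q
    + (\<Sum>l=0..k-Suc w. \<beta> (Suc w) l * (diff_coeff (Suc w) l p * diff_coeff (Suc w) l q))"
  by (simp add: diff_quad_def)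

lemma diff_quad_commute: "diff_quad k \<beta> w p q = diff_quad k \<beta> w q p"
  by (simp add: diff_quad_def mult.commute)

lemma diff_coeff_band: "p + j < q \<Longrightarrow> diff_coeff j l p * diff_coeff j l q = 0"
  by (auto simp: diff_coeff_def)

lemma diff_quad_band: "p + w < q \<Longrightarrow> diff_quad k \<beta> w p q = 0"
  unfolding diff_quad_def by (intro sum.neutral ballI) (simp add: diff_coeff_band)

text \<open>Both \<open>p\<close> and \<open>p + w\<close> lie in the support
  \<open>{l..l + w}\<close> only for \<open>l = p\<close>, where the two coefficients are 1 and
  \<open>(-1) ^ w\<close>.\<close>

lemma diff_coeff_edge:
  assumes "p + w \<le> k"
  shows "(\<Sum>l=0..k-w. c l * (diff_coeff w l p * diff_coeff w l (p + w))) = (-1) ^ w * c p"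
proof -
  have "(\<Sum>l=0..k-w. c l * (diff_coeff w l p * diff_coeff w l (p + w)))
      = (\<Sum>l=0..k-w. if l = p then (-1) ^ w * c p else 0)"
  proof (rule sum.cong[OF refl])
    fix l
    show "c l * (diff_coeff w l p * diff_coeff w l (p + w)) = (if l = p then (-1) ^ w * c p else 0)"
    proof (cases "l < p")
      case True
      then have "w < p + w - l" by auto
      with True show ?thesis by (simp add: diff_coeff_def)
    qed (auto simp: diff_coeff_def)
  qed
  also have "\<dots> = (-1) ^ w * c p"
    using assms by auto
  finally show ?thesis .
qed

lemma diff_quad_edge:
  assumes "p + Suc w \<le> k"
  shows "diff_quad k \<beta> (Suc w) p (p + Suc w) = (-1) ^ Suc w * \<beta> (Suc w) p"
  unfolding diff_quad_Suc diff_coeff_edge[OF assms] by (simp add: diff_quad_band)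

text \<open>Peeling off the outermost diagonals: on the diagonal \<open>q = p + w\<close> only the squares of the
  \<open>w\<close>-th differences contribute, and each entry there comes from exactly one of them.\<close>

lemma ex_diff_quad:
  assumes "w \<le> k" "\<And>p q. M p q = M q p"
    and "\<And>p. p \<le> k \<Longrightarrow> (\<Sum>q\<le>k. M p q) = 0"
    and "\<And>p q. p + w < q \<Longrightarrow> q \<le> k \<Longrightarrow> M p q = 0"
  shows "\<exists>\<beta>. \<forall>p\<le>k. \<forall>q\<le>k. M p q = diff_quad k \<beta> w p q"
  using assms
proof (induction w arbitrary: M)
  case 0
  have off: "M p q = 0" if "p \<le> k" "q \<le> k" "p \<noteq> q" for p q
    using 0(2)[of p q] 0(4)[of p q] 0(4)[of q p] that by (cases "p < q") auto
  \<comment> \<open>A diagonal matrix with zero row sums vanishes.\<close>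
  have "M p p = 0" if "p \<le> k" for p
  proof -
    have "(\<Sum>q\<le>k. M p q) = (\<Sum>q\<le>k. if q = p then M p p else 0)"
      using off that by (intro sum.cong) auto
    with 0(3)[OF that] that show ?thesis by simp
  qed
  with off have "\<forall>p\<le>k. \<forall>q\<le>k. M p q = 0" by metis
  then show ?case by (simp add: diff_quad_def)
next
  case (Suc w)
  \<comment> \<open>The only choice that clears the diagonal \<open>q = p + Suc w\<close>: the sign
    cancels the one in \<open>diff_coeff_edge\<close>.\<close>
  define b where "b l = (-1) ^ Suc w * M l (l + Suc w)" for l
  define E where "E p q = (\<Sum>l=0..k-Suc w. b l * (diff_coeff (Suc w) l p * diff_coeff (Suc w) l q))" for p q
  have "\<exists>\<beta>. \<forall>p\<le>k. \<forall>q\<le>k. M p q - E p q = diff_quad k \<beta> w p q"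
  proof (rule Suc.IH)
    show "w \<le> k" using Suc.prems by simp
    show "M p q - E p q = M q p - E q p" for p q
      using Suc.prems(2)[of p q] by (simp add: E_def mult.commute)
    show "(\<Sum>q\<le>k. M p q - E p q) = 0" if "p \<le> k" for p
    proof -
      have "(\<Sum>q\<le>k. E p q)
          = (\<Sum>l=0..k-Suc w. b l * diff_coeff (Suc w) l p * (\<Sum>q\<le>k. diff_coeff (Suc w) l q))"
        unfolding E_def sum_distrib_left by (subst sum.swap) (simp add: mult.assoc)
      also have "\<dots> = 0"
        using Suc.prems(1) by (intro sum.neutral ballI) (simp add: sum_diff_coeff_eq_0)
      finally show ?thesis using Suc.prems(3)[OF that] by (simp add: sum_subtractf)
    qed
    show "M p q - E p q = 0" if "p + w < q" "q \<le> k" for p q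
    proof (cases "q = p + Suc w")
      case True
      then have "E p q = (-1) ^ Suc w * b p"
        using that diff_coeff_edge[of p "Suc w" k b] by (simp add: E_def)
      also have "\<dots> = M p q"
        by (simp add: b_def True mult.assoc[symmetric] power_add[symmetric])
      finally show ?thesis by simp
    next
      case False
      with that have "p + Suc w < q" by simp
      then have "M p q = 0" "E p q = 0"
        using Suc.prems(4)[of p q] that by (auto simp: E_def diff_coeff_band)
      then show ?thesis by simp
    qed
  qed
  then obtain \<beta> where \<beta>: "\<forall>p\<le>k. \<forall>q\<le>k. M p q - E p q = diff_quad k \<beta> w p q" by blast
  have "M p q = diff_quad k (\<beta>(Suc w := b)) (Suc w) p q" if "p \<le> k" "q \<le> k" for p q
  proof -
    have "diff_quad k (\<beta>(Suc w := b)) w p q = diff_quad k \<beta> w p q"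
      unfolding diff_quad_def by (intro sum.cong) auto
    with \<beta> that show ?thesis
      unfolding diff_quad_Suc by (simp add: E_def algebra_simps)
  qed
  then show ?case by blast
qed

text \<open>By \<open>diff_quad_edge\<close> the outermost diagonal determines the coefficients of
  top order; these then cancel, and the next order is outermost.\<close>

lemma diff_quad_eq_imp_eq:
  assumes "w \<le> k" "\<And>p q. p \<le> k \<Longrightarrow> q \<le> k \<Longrightarrow> diff_quad k \<beta> w p q = diff_quad k \<beta>' w p q"
    and "1 \<le> j" "j \<le> w" "l \<le> k - j"
  shows "\<beta> j l = \<beta>' j l"
  using assms
proof (induction w arbitrary: j l)
  case 0
  then show ?case by simp
next
  case (Suc w)
  have top: "\<beta> (Suc w) i = \<beta>' (Suc w) i" if "i \<le> k - Suc w" for i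
    using Suc.prems(1) Suc.prems(2)[of i "i + Suc w"] diff_quad_edge[of i w k] that by auto
  have "diff_quad k \<beta> w p q = diff_quad k \<beta>' w p q" if "p \<le> k" "q \<le> k" for p q
    using Suc.prems(2)[OF that] top unfolding diff_quad_Suc by simp
  with Suc.IH[of j l] Suc.prems top show ?case
    by (cases "j = Suc w") auto
qed

subsection \<open>The BDF quadratic form\<close>

text \<open>This matches \<open>bdf_delta k 0\<close> with the remaining coefficients, so that all
  of them sum to 0.\<close>

lemma sum_inverse_eq_alternating_choose:
  "(\<Sum>r=1..k. 1 / real r) = - (\<Sum>i=1..k. (-1) ^ i / real i * real (k choose i))"
proof (induction k)
  case 0
  show ?case by simp
next
  case (Suc k)
  have "(\<Sum>i=1..Suc k. (-1) ^ i / real i * real (Suc k choose i))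
      = (\<Sum>i=1..Suc k. (-1) ^ i / real i * real (k choose i))
        + (\<Sum>i=1..Suc k. (-1) ^ i / real i * real (k choose (i - 1)))"
    unfolding sum.distrib[symmetric]
  proof (rule sum.cong[OF refl])
    fix i assume "i \<in> {1..Suc k}"
    then obtain m where "i = Suc m" by (cases i) auto
    then show "(-1) ^ i / real i * real (Suc k choose i)
      = (-1) ^ i / real i * real (k choose i) + (-1) ^ i / real i * real (k choose (i - 1))"
      by (simp add: algebra_simps)
  qed
  \<comment> \<open>Absorption, \<open>i * (Suc k choose i) = Suc k * (k choose (i - 1))\<close>,
    turns the Pascal increment into an alternating binomial sum without its first term.\<close>
  also have "(\<Sum>i=1..Suc k. (-1) ^ i / real i * real (k choose (i - 1)))
      = (\<Sum>i=1..Suc k. (-1) ^ i * real (Suc k choose i)) / real (Suc k)"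
    unfolding sum_divide_distrib
  proof (rule sum.cong[OF refl])
    fix i assume "i \<in> {1..Suc k}"
    then obtain m where m: "i = Suc m" by (cases i) auto
    have "real (Suc m) * real (Suc k choose Suc m) = real (Suc k) * real (k choose m)"
      using Suc_times_binomial_eq[of k m] by (metis mult.commute of_nat_mult)
    then show "(-1) ^ i / real i * real (k choose (i - 1)) = (-1) ^ i * real (Suc k choose i) / real (Suc k)"
      unfolding m by (simp add: field_simps del: binomial_Suc_Suc of_nat_Suc)
  qed
  also have "(\<Sum>i=1..Suc k. (-1) ^ i * real (Suc k choose i)) = -1"
    using choose_alternating_sum[of "Suc k", where ?'a = real]
      sum.atLeast_Suc_atMost[of 0 "Suc k" "\<lambda>i. (-1) ^ i * real (Suc k choose i)"]
    unfolding atMost_atLeast0 by (simp del: binomial_Suc_Suc sum.cl_ivl_Suc)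
  finally show ?case using Suc.IH by simp
qed

lemma sum_bdf_delta: "(\<Sum>p\<le>k. bdf_delta k p) = 0"
proof -
  have "(\<Sum>p\<le>k. bdf_delta k p) = bdf_delta k 0 + (\<Sum>p=1..k. bdf_delta k p)"
    unfolding atMost_atLeast0 by (subst sum.atLeast_Suc_atMost) auto
  also have "(\<Sum>p=1..k. bdf_delta k p) = (\<Sum>i=1..k. (-1) ^ i / real i * real (k choose i))"
    by (rule sum.cong) (auto simp: bdf_delta_def)
  finally show ?thesis
    using sum_inverse_eq_alternating_choose[of k] by (simp add: bdf_delta_def)
qed

text \<open>Puts the extrapolation on the same indices \<open>{0..k}\<close> as
  \<open>bdf_delta\<close>, with coefficient 0 at the current value \<open>u n\<close>.\<close>

definition bdf_shift :: "nat \<Rightarrow> nat \<Rightarrow> real" where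
  "bdf_shift k p = (if p = 0 then 0 else bdf_gamma k (p - 1))"

lemma bdf_hat_eq: "1 \<le> k \<Longrightarrow> bdf_hat k u n = (\<Sum>p\<le>k. bdf_shift k p *\<^sub>R u (n - p))"
proof (cases k)
  case (Suc m)
  show ?thesis
    unfolding Suc bdf_hat_def by (subst sum.atMost_Suc_shift) (simp add: bdf_shift_def atLeast0AtMost)
qed simp

lemma sum_bdf_shift:
  assumes "1 \<le> k"
  shows "(\<Sum>p\<le>k. bdf_shift k p) = 1"
proof -
  \<comment> \<open>These are the coefficients of \<open>1 - (1 - z) ^ k\<close>, evaluated at
    \<open>z = 1\<close>.\<close>
  have "(\<Sum>p\<le>k. bdf_shift k p) = (\<Sum>p\<le>k. (if p = 0 then 1 else 0) - (-1) ^ p * real (k choose p))"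
    by (rule sum.cong) (auto simp: bdf_shift_def bdf_gamma_def gr0_conv_Suc power_Suc)
  also have "\<dots> = 1"
    using assms choose_alternating_sum[of k, where ?'a = real] by (simp add: sum_subtractf)
  finally show ?thesis .
qed

text \<open>The matrix of the left-hand side of the identity defining \<open>\<beta>\<close>, in the variables \<open>a (n - p)\<close>.\<close>

definition bdf_quad :: "nat \<Rightarrow> nat \<Rightarrow> nat \<Rightarrow> real" where
  "bdf_quad k p q = (if p = q then bdf_delta k p else 0)
     - bdf_delta k p * bdf_shift k q - bdf_shift k p * bdf_delta k q"

lemma bdf_quad_commute: "bdf_quad k p q = bdf_quad k q p"
  by (simp add: bdf_quad_def)

text \<open>With \<open>\<delta>\<close> summing to 0 and the shifted \<open>\<gamma>\<close> to 1,
  the diagonal entry cancels against the first product and the second product sums to 0.\<close>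

lemma sum_bdf_quad:
  assumes "1 \<le> k" "p \<le> k"
  shows "(\<Sum>q\<le>k. bdf_quad k p q) = 0"
  using assms
  by (simp add: bdf_quad_def sum_subtractf sum_distrib_left[symmetric] sum_bdf_shift sum_bdf_delta)

lemma ex_bdf_quad_eq_diff_quad:
  assumes "1 \<le> k"
  shows "\<exists>\<beta>. \<forall>p\<le>k. \<forall>q\<le>k. bdf_quad k p q = diff_quad k \<beta> k p q"
  using assms bdf_quad_commute sum_bdf_quad by (intro ex_diff_quad) auto

section \<open>Evaluating the matrices on a bilinear map\<close>

lemma bilinear_sum_scaleR:
  assumes "bilinear B"
  shows "B (\<Sum>p\<in>S. a p *\<^sub>R x p) (\<Sum>q\<in>T. b q *\<^sub>R y q) = (\<Sum>p\<in>S. \<Sum>q\<in>T. (a p * b q) *\<^sub>R B (x p) (y q))"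
  by (simp add: bilinear_sum[OF assms] sum.cartesian_product bilinear_lmul[OF assms]
      bilinear_rmul[OF assms] mult.commute)

text \<open>The two product terms of \<open>bdf_quad\<close> are transposes of each other; symmetry
  of \<open>B\<close> merges them into the factor 2.\<close>

lemma bdf_quad_expand:
  assumes B: "bilinear B" and sym: "\<And>x y. B x y = B y x" and k: "1 \<le> k"
  shows "(\<Sum>p\<le>k. \<Sum>q\<le>k. bdf_quad k p q *\<^sub>R B (u (n - p)) (u (n - q)))
    = (\<Sum>j=0..k. bdf_delta k j *\<^sub>R B (u (n - j)) (u (n - j)))
      - 2 *\<^sub>R B (\<Sum>j=0..k. bdf_delta k j *\<^sub>R u (n - j)) (bdf_hat k u n)"
proof -
  have "(\<Sum>p\<le>k. \<Sum>q\<le>k. (if p = q then bdf_delta k p else 0) *\<^sub>R B (u (n - p)) (u (n - q)))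
     = (\<Sum>p\<le>k. bdf_delta k p *\<^sub>R B (u (n - p)) (u (n - p)))"
  proof (rule sum.cong[OF refl])
    fix p assume "p \<in> {..k}"
    have "(\<Sum>q\<le>k. (if p = q then bdf_delta k p else 0) *\<^sub>R B (u (n - p)) (u (n - q)))
       = (\<Sum>q\<le>k. if p = q then bdf_delta k p *\<^sub>R B (u (n - p)) (u (n - p)) else 0)"
      by (rule sum.cong) auto
    with \<open>p \<in> {..k}\<close> show "(\<Sum>q\<le>k. (if p = q then bdf_delta k p else 0) *\<^sub>R B (u (n - p)) (u (n - q)))
       = bdf_delta k p *\<^sub>R B (u (n - p)) (u (n - p))"
      by simp
  qed
  moreover have "(\<Sum>p\<le>k. \<Sum>q\<le>k. (bdf_delta k p * bdf_shift k q) *\<^sub>R B (u (n - p)) (u (n - q)))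
     = B (\<Sum>j=0..k. bdf_delta k j *\<^sub>R u (n - j)) (bdf_hat k u n)"
    by (simp add: bdf_hat_eq[OF k] bilinear_sum_scaleR[OF B] atLeast0AtMost)
  moreover have "(\<Sum>p\<le>k. \<Sum>q\<le>k. (bdf_shift k p * bdf_delta k q) *\<^sub>R B (u (n - p)) (u (n - q)))
     = B (\<Sum>j=0..k. bdf_delta k j *\<^sub>R u (n - j)) (bdf_hat k u n)"
    by (subst sym) (simp add: bdf_hat_eq[OF k] bilinear_sum_scaleR[OF B] atLeast0AtMost)
  ultimately show ?thesis
    by (simp add: bdf_quad_def scaleR_left_diff_distrib sum_subtractf atLeast0AtMost scaleR_2)
qed

lemma diff_quad_expand:
  assumes B: "bilinear B" and s: "s > 0"
  shows "(\<Sum>p\<le>k. \<Sum>q\<le>k. diff_quad k \<beta> k p q *\<^sub>R B (u (n - p)) (u (n - q)))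
    = (\<Sum>j=1..k. \<Sum>l=0..k-j. (\<beta> j l * s ^ (2 * j)) *\<^sub>R
         B (back_diff s j u (n - l)) (back_diff s j u (n - l)))"
proof -
  let ?t = "\<lambda>j l p q. (\<beta> j l * (diff_coeff j l p * diff_coeff j l q)) *\<^sub>R B (u (n - p)) (u (n - q))"
  have "(\<beta> j l * s ^ (2 * j)) *\<^sub>R B (back_diff s j u (n - l)) (back_diff s j u (n - l))
      = (\<Sum>p\<le>k. \<Sum>q\<le>k. ?t j l p q)" if "j \<in> {1..k}" "l \<in> {0..k-j}" for j l
  proof -
    have lj: "l + j \<le> k" using that by auto
    define r where "r = (1 / s) ^ j"
    define v where "v = (\<Sum>p\<le>k. diff_coeff j l p *\<^sub>R u (n - p))"
    \<comment> \<open>Each argument of \<open>B\<close> contributes one factor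
      \<open>(1 / s) ^ j\<close>, so the step size drops out.\<close>
    have r: "s ^ (2 * j) * (r * r) = 1"
      using s by (simp add: r_def power_divide mult_2 power_add)
    have "(\<beta> j l * s ^ (2 * j)) *\<^sub>R B (back_diff s j u (n - l)) (back_diff s j u (n - l))
        = (\<beta> j l * (s ^ (2 * j) * (r * r))) *\<^sub>R B v v"
      by (simp add: back_diff_eq_sum_diff_coeff[OF lj] bilinear_lmul[OF B] bilinear_rmul[OF B]
          mult.assoc flip: r_def v_def)
    also have "\<dots> = \<beta> j l *\<^sub>R B v v"
      by (simp add: r)
    also have "\<dots> = (\<Sum>p\<le>k. \<Sum>q\<le>k. ?t j l p q)"
      by (simp add: v_def bilinear_sum_scaleR[OF B] scaleR_sum_right)
    finally show ?thesis .
  qed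
  then have "(\<Sum>j=1..k. \<Sum>l=0..k-j. (\<beta> j l * s ^ (2 * j)) *\<^sub>R
         B (back_diff s j u (n - l)) (back_diff s j u (n - l)))
     = (\<Sum>j=1..k. \<Sum>l=0..k-j. \<Sum>p\<le>k. \<Sum>q\<le>k. ?t j l p q)"
    by simp
  \<comment> \<open>The range of \<open>l\<close> depends on \<open>j\<close>; one sum over pairs
    can be exchanged with the sums over \<open>p\<close> and \<open>q\<close>.\<close>
  also have "\<dots> = (\<Sum>x\<in>Sigma {1..k} (\<lambda>j. {0..k-j}). \<Sum>p\<le>k. \<Sum>q\<le>k. ?t (fst x) (snd x) p q)"
    by (subst sum.Sigma) (auto simp: case_prod_unfold)
  also have "\<dots> = (\<Sum>p\<le>k. \<Sum>q\<le>k. \<Sum>x\<in>Sigma {1..k} (\<lambda>j. {0..k-j}). ?t (fst x) (snd x) p q)"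
    by (subst sum.swap, rule sum.cong[OF refl], rule sum.swap)
  also have "\<dots> = (\<Sum>p\<le>k. \<Sum>q\<le>k. diff_quad k \<beta> k p q *\<^sub>R B (u (n - p)) (u (n - q)))"
  proof (intro sum.cong refl)
    fix p q
    show "(\<Sum>x\<in>Sigma {1..k} (\<lambda>j. {0..k-j}). ?t (fst x) (snd x) p q)
        = diff_quad k \<beta> k p q *\<^sub>R B (u (n - p)) (u (n - q))"
      unfolding diff_quad_def scaleR_sum_left by (subst sum.Sigma) (auto simp: case_prod_unfold)
  qed
  finally show ?thesis by simp
qed

section \<open>Well-definedness of the coefficients \<beta>\<close>

lemma quad_form_eq_0_imp:
  fixes M :: "nat \<Rightarrow> nat \<Rightarrow> real"
  assumes sym: "\<And>p q. M p q = M q p"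
    and zero: "\<And>x. (\<Sum>p\<le>k. \<Sum>q\<le>k. M p q * (x p * x q)) = 0"
    and "i \<le> k" "m \<le> k"
  shows "M i m = 0"
proof -
  have ind: "(\<Sum>p\<le>k. \<Sum>q\<le>k. M p q * (indicator {i} p * indicator {m} q)) = M i m"
    if "i \<le> k" "m \<le> k" for i m :: nat
  proof -
    have "(\<Sum>p\<le>k. \<Sum>q\<le>k. M p q * (indicator {i} p * indicator {m} q))
        = (\<Sum>p\<le>k. if p = i then M i m else 0)"
    proof (rule sum.cong[OF refl])
      fix p
      have "(\<Sum>q\<le>k. M p q * (indicator {i} p * indicator {m} q))
          = (\<Sum>q\<le>k. if q = m then M p m * indicator {i} p else 0)"
        by (rule sum.cong) (auto simp: indicator_def)
      with that show "(\<Sum>q\<le>k. M p q * (indicator {i} p * indicator {m} q)) = (if p = i then M i m else 0)"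
        by (auto simp: indicator_def)
    qed
    with that show ?thesis by simp
  qed
  \<comment> \<open>Polarization: the sum of two unit vectors isolates \<open>M i m + M m i\<close>;
    it also covers \<open>i = m\<close>.\<close>
  let ?x = "\<lambda>p. indicator {i} p + indicator {m} p :: real"
  have "0 = (\<Sum>p\<le>k. \<Sum>q\<le>k. M p q * (?x p * ?x q))"
    using zero[of ?x] by simp
  also have "\<dots> = M i i + M i m + M m i + M m m"
    using assms(3,4) by (simp add: algebra_simps sum.distrib ind[symmetric])
  also have "M i i = 0" using zero[of "indicator {i}"] ind[of i i] assms(3) by simp
  also have "M m m = 0" using zero[of "indicator {m}"] ind[of m m] assms(4) by simp
  finally show ?thesis using sym[of i m] by simp
qed

text \<open>Both sides of the defining identity are quadratic forms in the values
  \<open>a (n - p)\<close>, obtained by taking \<open>B\<close> to be multiplication; a symmetric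
  matrix is determined by its form.\<close>

lemma is_bdf_beta_iff:
  assumes k: "1 \<le> k"
  shows "is_bdf_beta k \<beta> \<longleftrightarrow> (\<forall>p\<le>k. \<forall>q\<le>k. bdf_quad k p q = diff_quad k \<beta> k p q)"
proof -
  have mult: "bilinear ((*) :: real \<Rightarrow> real \<Rightarrow> real)"
    by (simp add: bilinear_times)
  have eq: "is_bdf_beta k \<beta> \<longleftrightarrow> (\<forall>s>0::real. \<forall>a :: nat \<Rightarrow> real. \<forall>n\<ge>k.
      (\<Sum>p\<le>k. \<Sum>q\<le>k. bdf_quad k p q *\<^sub>R (a (n - p) * a (n - q)))
      = (\<Sum>p\<le>k. \<Sum>q\<le>k. diff_quad k \<beta> k p q *\<^sub>R (a (n - p) * a (n - q))))" (is "_ \<longleftrightarrow> ?R")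
    unfolding is_bdf_beta_def bdf_quad_expand[OF mult mult.commute k]
  proof (rule iff_allI, rule imp_cong[OF refl], rule iff_allI, rule iff_allI, rule imp_cong[OF refl])
    fix s :: real and a :: "nat \<Rightarrow> real" and n
    assume "s > 0"
    from diff_quad_expand[OF mult this, of k \<beta> a n]
    show "((\<Sum>j=0..k. bdf_delta k j * (a (n - j))\<^sup>2)
          - 2 * (\<Sum>j=0..k. bdf_delta k j * a (n - j)) * (\<Sum>j=0..k-1. bdf_gamma k j * a (n - j - 1))
        = (\<Sum>j=1..k. \<Sum>l=0..k-j. \<beta> j l * s ^ (2 * j) * (back_diff s j a (n - l))\<^sup>2))
      \<longleftrightarrow> ((\<Sum>j=0..k. bdf_delta k j *\<^sub>R (a (n - j) * a (n - j)))
          - 2 *\<^sub>R ((\<Sum>j=0..k. bdf_delta k j *\<^sub>R a (n - j)) * bdf_hat k a n)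
        = (\<Sum>p\<le>k. \<Sum>q\<le>k. diff_quad k \<beta> k p q *\<^sub>R (a (n - p) * a (n - q))))"
      by (simp add: bdf_hat_def power2_eq_square mult.assoc)
  qed
  show ?thesis
  proof
    assume "is_bdf_beta k \<beta>"
    then have R: ?R using eq by blast
    have "bdf_quad k i m - diff_quad k \<beta> k i m = 0" if im: "i \<le> k" "m \<le> k" for i m
    proof (rule quad_form_eq_0_imp[OF _ _ im])
      show "bdf_quad k p q - diff_quad k \<beta> k p q = bdf_quad k q p - diff_quad k \<beta> k q p" for p q
        by (metis bdf_quad_commute diff_quad_commute)
      fix x :: "nat \<Rightarrow> real"
      show "(\<Sum>p\<le>k. \<Sum>q\<le>k. (bdf_quad k p q - diff_quad k \<beta> k p q) * (x p * x q)) = 0"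
        \<comment> \<open>At \<open>n = k\<close> the reversed sequence satisfies
          \<open>a (k - p) = x p\<close>, so every vector \<open>x\<close> on \<open>{0..k}\<close>
          occurs.\<close>
        using R[rule_format, of 1 k "\<lambda>i. x (k - i)"] by (simp add: left_diff_distrib sum_subtractf)
    qed
    then show "\<forall>p\<le>k. \<forall>q\<le>k. bdf_quad k p q = diff_quad k \<beta> k p q" by simp
  qed (simp add: eq)
qed

lemma is_bdf_beta_bdf_beta:
  assumes k: "1 \<le> k"
  shows "is_bdf_beta k (bdf_beta k)"
proof -
  let ?P = "\<lambda>\<beta>. is_bdf_beta k \<beta> \<and> (\<forall>j l. \<not> (1 \<le> j \<and> j \<le> k \<and> l \<le> k - j) \<longrightarrow> \<beta> j l = 0)"
  obtain \<beta>\<^sub>0 where \<beta>\<^sub>0: "\<forall>p\<le>k. \<forall>q\<le>k. bdf_quad k p q = diff_quad k \<beta>\<^sub>0 k p q"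
    using ex_bdf_quad_eq_diff_quad[OF k] by blast
  \<comment> \<open>The description defining \<open>bdf_beta\<close> demands the value 0 off the
    index triangle; the form does not see this change.\<close>
  define \<beta>\<^sub>1 where "\<beta>\<^sub>1 j l = (if 1 \<le> j \<and> j \<le> k \<and> l \<le> k - j then \<beta>\<^sub>0 j l else 0)" for j l
  have "diff_quad k \<beta>\<^sub>1 k p q = diff_quad k \<beta>\<^sub>0 k p q" for p q
    unfolding diff_quad_def by (intro sum.cong) (auto simp: \<beta>\<^sub>1_def)
  with \<beta>\<^sub>0 have P: "?P \<beta>\<^sub>1"
    by (simp add: is_bdf_beta_iff[OF k] \<beta>\<^sub>1_def)
  have "\<beta> = \<beta>\<^sub>1" if "?P \<beta>" for \<beta>
  proof (intro ext)
    fix j l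
    show "\<beta> j l = \<beta>\<^sub>1 j l"
    proof (cases "1 \<le> j \<and> j \<le> k \<and> l \<le> k - j")
      case True
      then show ?thesis
        using that P diff_quad_eq_imp_eq[of k k \<beta> \<beta>\<^sub>1 j l] by (simp add: is_bdf_beta_iff[OF k])
    qed (use that P in metis)
  qed
  with P have "?P (bdf_beta k)"
    unfolding bdf_beta_def by (rule theI2) blast+
  then show ?thesis by blast
qed

text \<open>The linearized constraint removes the mixed term of \<open>bdf_quad_expand\<close>;
  equality of the matrices, known from scalars, does the rest.\<close>

lemma sum_bdf_delta_bilinear:
  assumes "bilinear B" "\<And>x y. B x y = B y x" "1 \<le> k" "s > 0"
    and "B (bdf_dot k s u n) (bdf_hat k u n) = 0"
  shows "(\<Sum>j=0..k. bdf_delta k j *\<^sub>R B (u (n - j)) (u (n - j))) = bdf_phi k s B u n"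
proof -
  have "B (\<Sum>j=0..k. bdf_delta k j *\<^sub>R u (n - j)) (bdf_hat k u n) = 0"
    using assms(4,5) by (simp add: bdf_dot_def bilinear_lmul[OF assms(1)])
  moreover have "(\<Sum>p\<le>k. \<Sum>q\<le>k. bdf_quad k p q *\<^sub>R B (u (n - p)) (u (n - q)))
      = (\<Sum>p\<le>k. \<Sum>q\<le>k. diff_quad k (bdf_beta k) k p q *\<^sub>R B (u (n - p)) (u (n - q)))"
    using is_bdf_beta_bdf_beta[OF assms(3)] by (simp add: is_bdf_beta_iff[OF assms(3)])
  ultimately show ?thesis
    by (simp add: bdf_quad_expand[OF assms(1-3)] diff_quad_expand[OF assms(1,4)] bdf_phi_def)
qed

subsection \<open>The coefficients of the inverse generating function\<close>

lemma higher_deriv_has_fps_expansion: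
  "f has_fps_expansion F \<Longrightarrow> (deriv ^^ n) f has_fps_expansion (fps_deriv ^^ n) F"
  by (induction n) (auto intro: has_fps_expansion_deriv)

text \<open>Links the Taylor coefficients in \<open>bdf_eta\<close> to formal power series, where
  inversion is algebraic.\<close>

lemma has_fps_expansion_imp_higher_deriv_0:
  fixes F :: "real fps"
  assumes "f has_fps_expansion F"
  shows "(deriv ^^ n) f 0 / fact n = fps_nth F n"
proof -
  have "\<forall>\<^sub>F z in nhds 0. eval_fps ((fps_deriv ^^ n) F) z = (deriv ^^ n) f z"
    using higher_deriv_has_fps_expansion[OF assms] unfolding has_fps_expansion_def by blast
  then have "eval_fps ((fps_deriv ^^ n) F) 0 = (deriv ^^ n) f 0"
    by (rule eventually_nhds_x_imp_x)
  then have "(deriv ^^ n) f 0 = fps_nth ((fps_deriv ^^ n) F) 0"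
    by (simp add: eval_fps_at_0)
  then show ?thesis by (simp add: fps_0th_higher_deriv)
qed

lemma bdf_delta_tilde_Suc: "bdf_delta_tilde k (Suc j) = bdf_delta_tilde k j + bdf_delta k (Suc j)"
  by (simp add: bdf_delta_tilde_def)

lemma bdf_delta_tilde_0_pos:
  assumes "1 \<le> k"
  shows "bdf_delta_tilde k 0 > 0"
  unfolding bdf_delta_tilde_def bdf_delta_def using assms by (auto intro!: sum_pos)

definition bdf_fps :: "nat \<Rightarrow> real fps" where
  "bdf_fps k = Abs_fps (\<lambda>j. if j < k then bdf_delta_tilde k j else 0)"

lemma bdf_delta_tilde_fun_has_fps_expansion:
  assumes "1 \<le> k"
  shows "bdf_delta_tilde_fun k has_fps_expansion bdf_fps k"
proof -
  have "bdf_fps k = (\<Sum>j=0..k-1. fps_const (bdf_delta_tilde k j) * fps_X ^ j)"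
  proof (rule fps_ext)
    fix n
    have "fps_nth (\<Sum>j=0..k-1. fps_const (bdf_delta_tilde k j) * fps_X ^ j) n
        = (\<Sum>j=0..k-1. if j = n then bdf_delta_tilde k j else 0)"
      unfolding fps_sum_nth by (rule sum.cong) (auto simp: fps_X_power_nth)
    then show "fps_nth (bdf_fps k) n = fps_nth (\<Sum>j=0..k-1. fps_const (bdf_delta_tilde k j) * fps_X ^ j) n"
      using assms by (auto simp: bdf_fps_def)
  qed
  moreover have "bdf_delta_tilde_fun k = (\<lambda>z. \<Sum>j=0..k-1. bdf_delta_tilde k j * z ^ j)"
    by (rule ext) (simp add: bdf_delta_tilde_fun_def)
  ultimately show ?thesis
    by (simp add: fps_expansion_intros)
qed

lemma bdf_eta_eq_fps_nth:
  assumes "1 \<le> k"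
  shows "bdf_eta k (int n) = fps_nth (inverse (bdf_fps k)) n"
proof -
  have "fps_nth (bdf_fps k) 0 \<noteq> 0"
    using assms bdf_delta_tilde_0_pos[OF assms] by (simp add: bdf_fps_def)
  then have "(\<lambda>z. 1 / bdf_delta_tilde_fun k z) has_fps_expansion inverse (bdf_fps k)"
    using has_fps_expansion_inverse[OF bdf_delta_tilde_fun_has_fps_expansion[OF assms]]
    by (simp add: inverse_eq_divide)
  from has_fps_expansion_imp_higher_deriv_0[OF this, of n] show ?thesis
    by (simp add: bdf_eta_def)
qed

lemma bdf_eta_neg: "j < 0 \<Longrightarrow> bdf_eta k j = 0"
  by (simp add: bdf_eta_def)

text \<open>The \<open>n\<close>-th coefficient of a power series times its inverse.\<close>

lemma bdf_eta_convolution: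
  assumes "1 \<le> k"
  shows "(\<Sum>j<k. bdf_delta_tilde k j * bdf_eta k (int n - int j)) = (if n = 0 then 1 else 0)"
proof -
  have "fps_nth (bdf_fps k) 0 \<noteq> 0"
    using assms bdf_delta_tilde_0_pos[OF assms] by (simp add: bdf_fps_def)
  then have "bdf_fps k * inverse (bdf_fps k) = 1"
    by (rule inverse_mult_eq_1')
  then have "(if n = 0 then 1 else 0) = (\<Sum>j=0..n. fps_nth (bdf_fps k) j * fps_nth (inverse (bdf_fps k)) (n - j))"
    by (metis fps_mult_nth fps_one_nth)
  also have "\<dots> = (\<Sum>j=0..n. if j < k then bdf_delta_tilde k j * bdf_eta k (int n - int j) else 0)"
    by (rule sum.cong)
       (auto simp: bdf_eta_eq_fps_nth[OF assms, symmetric] of_nat_diff bdf_fps_def[THEN arg_cong[where f = fps_nth]])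
  also have "\<dots> = (\<Sum>j\<in>{0..n} \<inter> {..<k}. bdf_delta_tilde k j * bdf_eta k (int n - int j))"
    by (simp add: sum.inter_restrict)
  \<comment> \<open>The added terms have \<open>j > n\<close>, where \<eta> has negative index and
    is 0.\<close>
  also have "\<dots> = (\<Sum>j<k. bdf_delta_tilde k j * bdf_eta k (int n - int j))"
    by (rule sum.mono_neutral_left) (auto intro: bdf_eta_neg)
  finally show ?thesis by simp
qed

subsection \<open>The defect recursion\<close>

lemma sum_by_parts_bdf_delta:
  fixes x :: "nat \<Rightarrow> 'a::real_vector"
  shows "(\<Sum>j\<le>m. bdf_delta k j *\<^sub>R x j)
    = bdf_delta_tilde k m *\<^sub>R x m + (\<Sum>j<m. bdf_delta_tilde k j *\<^sub>R (x j - x (Suc j)))"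
proof (induction m)
  case 0
  show ?case by (simp add: bdf_delta_tilde_def)
next
  case (Suc m)
  then show ?case by (simp add: bdf_delta_tilde_Suc algebra_simps)
qed

text \<open>Abel summation; the boundary term vanishes because \<open>bdf_delta_tilde k k\<close> is
  the full sum of the \<delta>. In generating functions,
  \<open>\<delta>(z) = (1 - z) \<delta>~(z)\<close>.\<close>

lemma bdf_delta_sum_eq_diff:
  fixes b :: "nat \<Rightarrow> 'a::real_vector"
  assumes "1 \<le> k"
  shows "(\<Sum>j\<le>k. bdf_delta k j *\<^sub>R b (n - j))
    = (\<Sum>j<k. bdf_delta_tilde k j *\<^sub>R b (n - j)) - (\<Sum>j<k. bdf_delta_tilde k j *\<^sub>R b (n - 1 - j))"
proof -
  have "bdf_delta_tilde k k = 0"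
    using sum_bdf_delta[of k] by (simp add: bdf_delta_tilde_def atLeast0AtMost)
  then show ?thesis
    using sum_by_parts_bdf_delta[of k "\<lambda>j. b (n - j)" k]
    by (simp add: sum_subtractf scaleR_diff_right)
qed

text \<open>Collecting by \<open>m = n - j\<close> gives a full convolution for
  \<open>m \<ge> k\<close>, leaving only \<open>b N\<close>. For \<open>m < k\<close> the bound
  \<open>n \<ge> k\<close> leaves the tail \<open>l \<ge> k - m\<close>, the correction by starting
  values.\<close>

lemma bdf_eta_double_sum:
  fixes b :: "nat \<Rightarrow> 'a::real_vector"
  assumes k: "1 \<le> k" and N: "k \<le> N" and b0: "b 0 = 0"
  shows "(\<Sum>n=k..N. bdf_eta k (int N - int n) *\<^sub>R (\<Sum>j<k. bdf_delta_tilde k j *\<^sub>R b (n - j)))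
    = b N + (\<Sum>m=1..k-1. (\<Sum>l=k-m..k-1. bdf_delta_tilde k l * bdf_eta k (int N - int l - int m)) *\<^sub>R b m)"
proof -
  let ?c = "\<lambda>m l. bdf_delta_tilde k l * bdf_eta k (int N - int l - int m)"
  have "(\<Sum>n=k..N. bdf_eta k (int N - int n) *\<^sub>R (\<Sum>j<k. bdf_delta_tilde k j *\<^sub>R b (n - j)))
      = (\<Sum>(n, j)\<in>{k..N} \<times> {..<k}. (bdf_eta k (int N - int n) * bdf_delta_tilde k j) *\<^sub>R b (n - j))"
    by (simp add: scaleR_sum_right sum.cartesian_product)
  also have "\<dots> = (\<Sum>(m, l)\<in>Sigma {..N} (\<lambda>m. {k-m..<k}). ?c m l *\<^sub>R b m)"
    \<comment> \<open>\<open>T'\<close> holds the pairs with \<open>m + l > N\<close>, which come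
      from no \<open>n \<le> N\<close>; there \<eta> has negative index.\<close>
    by (rule sum.reindex_bij_witness_not_neutral[where S' = "{}"
          and T' = "{(m, l) \<in> Sigma {..N} (\<lambda>m. {k-m..<k}). N < m + l}"
          and i = "\<lambda>(m, l). (m + l, l)" and j = "\<lambda>(n, j). (n - j, j)"])
       (auto simp: bdf_eta_neg of_nat_diff mult.commute intro: finite_subset[of _ "{..N} \<times> {..<k}"])
  also have "\<dots> = (\<Sum>m\<le>N. (\<Sum>l=k-m..<k. ?c m l) *\<^sub>R b m)"
    by (simp add: sum.Sigma[symmetric] scaleR_sum_left)
  also have "{..N} = {0} \<union> {1..k-1} \<union> {k..N}"
    using k N by auto
  also have "(\<Sum>m\<in>\<dots>. (\<Sum>l=k-m..<k. ?c m l) *\<^sub>R b m)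
      = (\<Sum>m=1..k-1. (\<Sum>l=k-m..<k. ?c m l) *\<^sub>R b m) + (\<Sum>m=k..N. (\<Sum>l=k-m..<k. ?c m l) *\<^sub>R b m)"
    using k by (subst sum.union_disjoint; (subst sum.union_disjoint)?) (auto simp: b0)
  also have "(\<Sum>m=k..N. (\<Sum>l=k-m..<k. ?c m l) *\<^sub>R b m) = (\<Sum>m=k..N. if m = N then b N else 0)"
  proof (rule sum.cong[OF refl])
    \<comment> \<open>Here truncated \<open>k - m\<close> is 0, so \<open>l\<close> runs over all of
      \<open>{0..<k}\<close>.\<close>
    fix m assume "m \<in> {k..N}"
    then have "(\<Sum>l=k-m..<k. ?c m l) = (if m = N then 1 else 0)"
      using bdf_eta_convolution[OF k, of "N - m"]
      by (auto simp: atLeast0LessThan of_nat_diff algebra_simps)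
    then show "(\<Sum>l=k-m..<k. ?c m l) *\<^sub>R b m = (if m = N then b N else 0)"
      by simp
  qed
  also have "\<dots> = b N"
    using N by simp
  finally have "(\<Sum>n=k..N. bdf_eta k (int N - int n) *\<^sub>R (\<Sum>j<k. bdf_delta_tilde k j *\<^sub>R b (n - j)))
      = (\<Sum>m=1..k-1. (\<Sum>l=k-m..<k. ?c m l) *\<^sub>R b m) + b N" .
  moreover have "{k-m..<k} = {k-m..k-1}" for m
    using k by auto
  ultimately show ?thesis by simp
qed

theorem theorem3p3:
  fixes B :: "'u::{real_inner,complete_space} \<Rightarrow> 'u \<Rightarrow> 'z::real_normed_vector"
    and u_c :: 'z and s :: real and u :: "nat \<Rightarrow> 'u" and k N :: nat
  assumes B_bilinear: "bilinear B"
    and B_symmetric: "\<And>x y. B x y = B y x"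
    and s_pos: "s > 0"
    and k_range: "2 \<le> k" "k \<le> 6"
    and initial: "B (u 0) (u 0) = u_c"
    and linearized: "\<And>n. n \<ge> k \<Longrightarrow> B (bdf_dot k s u n) (bdf_hat k u n) = 0"
    and N_ge: "N \<ge> k"
  shows "constraint_defect B u_c u N =
    (\<Sum>m=1..k-1.
       (bdf_delta_tilde k (k - 1 - m) * (\<Sum>n=k..N. bdf_eta k (int N - int n))
        - (\<Sum>l=k-m..k-1. bdf_delta_tilde k l * bdf_eta k (int N - int l - int m)))
       *\<^sub>R constraint_defect B u_c u m)
    + (\<Sum>n=k..N. bdf_eta k (int N - int n) *\<^sub>R (\<Sum>m=k..n. bdf_phi k s B u m))"
proof -
  have k: "1 \<le> k" using k_range by simp
  define b where "b = constraint_defect B u_c u"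
  define S where "S n = (\<Sum>j<k. bdf_delta_tilde k j *\<^sub>R b (n - j))" for n
  let ?\<eta> = "\<lambda>n. bdf_eta k (int N - int n)"
  have b0: "b 0 = 0"
    by (simp add: b_def constraint_defect_def initial)
  have step: "S n = S (n - 1) + bdf_phi k s B u n" if "n \<ge> k" for n
  proof -
    \<comment> \<open>The constant \<open>u_c\<close> drops out because the \<delta> sum to
      0.\<close>
    have "(\<Sum>j\<le>k. bdf_delta k j *\<^sub>R b (n - j))
        = (\<Sum>j\<le>k. bdf_delta k j *\<^sub>R B (u (n - j)) (u (n - j))) - (\<Sum>j\<le>k. bdf_delta k j) *\<^sub>R u_c"
      by (simp add: b_def constraint_defect_def scaleR_diff_right sum_subtractf scaleR_sum_left)
    also have "\<dots> = bdf_phi k s B u n"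
      using sum_bdf_delta_bilinear[OF B_bilinear B_symmetric k s_pos linearized[OF that]]
      by (simp add: sum_bdf_delta atLeast0AtMost)
    finally show ?thesis
      using bdf_delta_sum_eq_diff[OF k, of b n] by (simp add: S_def algebra_simps)
  qed
  have S: "S n = S (k - 1) + (\<Sum>m=k..n. bdf_phi k s B u m)" if "n \<ge> k" for n
    using that
  proof (induction n rule: nat_induct_at_least)
    case base
    show ?case using step[of k] by simp
  next
    case (Suc n)
    then show ?case using step[of "Suc n"] by (simp add: add.assoc)
  qed
  have S_init: "S (k - 1) = (\<Sum>m=1..k-1. bdf_delta_tilde k (k - 1 - m) *\<^sub>R b m)"
  proof -
    have "S (k - 1) = (\<Sum>m<k. bdf_delta_tilde k (k - Suc (k - Suc m)) *\<^sub>R b (k - Suc m))"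
      unfolding S_def by (rule sum.cong) auto
    also have "\<dots> = (\<Sum>m<k. bdf_delta_tilde k (k - Suc m) *\<^sub>R b m)"
      by (rule sum.nat_diff_reindex)
    also have "\<dots> = (\<Sum>m=1..k-1. bdf_delta_tilde k (k - Suc m) *\<^sub>R b m)"
      \<comment> \<open>The term \<open>m = 0\<close> disappears by the initial condition
        \<open>b 0 = 0\<close>.\<close>
      by (rule sum.mono_neutral_right) (use k b0 in \<open>auto simp: not_le\<close>)
    finally show ?thesis by simp
  qed
  \<comment> \<open>Convolving \<open>S\<close> with \<eta> in two ways: by collecting the
    \<open>b m\<close>, and by inserting the summed recursion.\<close>
  have "b N + (\<Sum>m=1..k-1. (\<Sum>l=k-m..k-1. bdf_delta_tilde k l * bdf_eta k (int N - int l - int m)) *\<^sub>R b m)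
      = (\<Sum>n=k..N. ?\<eta> n *\<^sub>R S n)"
    using bdf_eta_double_sum[where b = b, OF k N_ge b0] by (simp add: S_def)
  also have "\<dots> = (\<Sum>n=k..N. ?\<eta> n *\<^sub>R S (k - 1) + ?\<eta> n *\<^sub>R (\<Sum>m=k..n. bdf_phi k s B u m))"
    by (rule sum.cong) (use S in \<open>auto simp: scaleR_add_right\<close>)
  also have "\<dots> = (\<Sum>m=1..k-1. (bdf_delta_tilde k (k - 1 - m) * (\<Sum>n=k..N. ?\<eta> n)) *\<^sub>R b m)
      + (\<Sum>n=k..N. ?\<eta> n *\<^sub>R (\<Sum>m=k..n. bdf_phi k s B u m))"
    unfolding sum.distrib scaleR_sum_left[symmetric] S_init by (simp add: scaleR_sum_right mult.commute)
  finally show ?thesis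
    unfolding b_def[symmetric]
    by (simp add: scaleR_left_diff_distrib sum_subtractf algebra_simps)
qed

end
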